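(* Let $m \geq 2$, let $D \subset \mathbb{R}^m$ be a domain, and let $u \in C^2(D)$ be harmonic in $D$. Then for every $x \in D$ and every $r > 0$ with $\overline{B_r(x)} \subset D$, \[ (m\,\alpha^{-1} - 1)\, r^{\alpha - m}\, u(x) = \frac{1}{|B_r|} \int_{B_r(x)} u(y) \left[ |x-y|^{\alpha-m} - r^{\alpha-m} \right] \mathrm{d}y \quad \text{for every } \alpha \in (0,m), \] and \[ \left[ 1 - \frac{m}{m+\beta} \right] r^\beta\, u(x) = \frac{1}{|B_r|} \int_{B_r(x)} u(y) \left[ r^\beta - |x-y|^\beta \right] \mathrm{d}y \quad \text{for every } \beta > 0 . \] Moreover, for any $x \in \mathbb{R}^m$, $r>0$, $\alpha \in (0,m)$ and $\beta>0$, both functions $y \mapsto |x-y|^{\alpha-m} - r^{\alpha-m}$ and $y \mapsto r^\beta - |x-y|^\beta$ are integrable over any bounded domain.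
   Context: $B_r(x) = \{y : |y-x| < r\}$ and $|B_r|$ denotes its Lebesgue measure. *)

theory Defs
  imports "HOL-Analysis.Analysis"
begin

definition C2_with :: "'a::euclidean_space set \<Rightarrow> ('a \<Rightarrow> real)
    \<Rightarrow> ('a \<Rightarrow> 'a \<Rightarrow> real) \<Rightarrow> ('a \<Rightarrow> 'a \<Rightarrow> 'a \<Rightarrow> real) \<Rightarrow> bool" where
  "C2_with D u u' u'' \<longleftrightarrow>
     (\<forall>x\<in>D. (u has_derivative u' x) (at x)) \<and>
     (\<forall>x\<in>D. \<forall>v. ((\<lambda>y. u' y v) has_derivative u'' x v) (at x)) \<and>
     (\<forall>v w. continuous_on D (\<lambda>x. u'' x v w))"

definition C2_on :: "'a::euclidean_space set \<Rightarrow> ('a \<Rightarrow> real) \<Rightarrow> bool" where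
  "C2_on D u \<longleftrightarrow> (\<exists>u' u''. C2_with D u u' u'')"

definition harmonic_on :: "'a::euclidean_space set \<Rightarrow> ('a \<Rightarrow> real) \<Rightarrow> bool" where
  "harmonic_on D u \<longleftrightarrow>
     (\<exists>u' u''. C2_with D u u' u'' \<and> (\<forall>x\<in>D. (\<Sum>b\<in>Basis. u'' x b b) = 0))"

end

theory Submission
  imports Defs
begin

text \<open>Put \<open>p = \<alpha> - m\<close> or \<open>p = \<beta>\<close>; then \<open>p + m > 0\<close> and both formulas say that
  \<open>u\<close> integrated over the ball against \<open>r powr p - |x - y| powr p\<close> gives
  \<open>p / (p + m) * r powr p * |B| * u x\<close>. Writing the weight as the integral of
  \<open>p * t powr (p - 1)\<close> over \<open>|x - y| \<le> t \<le> r\<close> and applying Fubini reduces this to the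
  mean value property over concentric balls.

  For the mean value property, the derivative in \<open>\<rho>\<close> of the integral of \<open>u (x + \<rho> z)\<close> over
  the unit ball is the integral of \<open>\<nabla>u (x + \<rho> z) \<bullet> z\<close>. As \<open>z\<close> is a multiple of the gradient
  of \<open>1 - z \<bullet> z\<close>, which vanishes on the unit sphere, integration by parts turns this into an
  integral of the Laplacian, which is \<open>0\<close>. The integration by parts needs no surface integrals:
  it only uses translation invariance of Lebesgue measure.\<close>

section \<open>Differentiation under the integral sign and Lipschitz bounds\<close>

text \<open>Dominated convergence along sequences tending to \<open>t0\<close>: the Lipschitz
  estimate bounds every difference quotient by \<open>L\<close>. Pointwise differentiability is only
  asked almost everywhere, which admits a function with a kink on a sphere, and
  \<open>within T\<close> covers the endpoints of an interval of radii.\<close>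

lemma has_field_derivative_integral:
  fixes f :: "real \<Rightarrow> 'a \<Rightarrow> real"
  assumes int: "\<And>t. t \<in> T \<Longrightarrow> integrable M (f t)" and t0: "t0 \<in> T"
    and deriv: "AE z in M. ((\<lambda>t. f t z) has_field_derivative f' z) (at t0 within T)"
    and meas: "f' \<in> borel_measurable M" and L: "integrable M L"
    and lip: "\<And>t z. t \<in> T \<Longrightarrow> \<bar>f t z - f t0 z\<bar> \<le> L z * \<bar>t - t0\<bar>"
  shows "((\<lambda>t. \<integral>z. f t z \<partial>M) has_field_derivative (\<integral>z. f' z \<partial>M)) (at t0 within T)"
  unfolding has_field_derivative_iff tendsto_at_iff_sequentially
proof (intro allI impI)
  fix X assume X: "\<forall>i. X i \<in> T - {t0}" "X \<longlonglongrightarrow> t0"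
  let ?q = "\<lambda>i z. (f (X i) z - f t0 z) / (X i - t0)"
  have "(\<lambda>i. \<integral>z. ?q i z \<partial>M) \<longlonglongrightarrow> (\<integral>z. f' z \<partial>M)"
  proof (rule integral_dominated_convergence[where w = L])
    show "?q i \<in> borel_measurable M" for i
      using X(1) int[of "X i"] int[OF t0] by (intro borel_measurable_divide) auto
    show "AE z in M. (\<lambda>i. ?q i z) \<longlonglongrightarrow> f' z"
      using deriv
      by eventually_elim
        (use X in \<open>auto simp: has_field_derivative_iff tendsto_at_iff_sequentially o_def\<close>)
    show "AE z in M. norm (?q i z) \<le> L z" for i
      using X(1) lip[of "X i"] by (auto simp: divide_le_eq)
  qed (use meas L in auto)
  moreover have "(\<integral>z. ?q i z \<partial>M) = ((\<integral>z. f (X i) z \<partial>M) - (\<integral>z. f t0 z \<partial>M)) / (X i - t0)" for i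
    using X(1) int[of "X i"] int[OF t0] by simp
  ultimately show "((\<lambda>y. ((\<integral>z. f y z \<partial>M) - (\<integral>z. f t0 z \<partial>M)) / (y - t0)) \<circ> X)
      \<longlonglongrightarrow> (\<integral>z. f' z \<partial>M)"
    unfolding o_def by (simp only:)
qed

lemma linear_euclidean_expansion:
  fixes f :: "'a::euclidean_space \<Rightarrow> real"
  assumes "linear f"
  shows "f v = (\<Sum>b\<in>Basis. (v \<bullet> b) * f b)"
proof -
  have "f v = f (\<Sum>b\<in>Basis. (v \<bullet> b) *\<^sub>R b)"
    by (simp add: euclidean_representation)
  also have "\<dots> = (\<Sum>b\<in>Basis. (v \<bullet> b) * f b)"
    using assms by (simp add: linear_sum linear_cmul)
  finally show ?thesis .
qed

text \<open>By compactness each directional derivative is bounded on \<open>S\<close>. The sum of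
  the bounds over the basis directions controls the operator norm of \<open>f' w\<close>, and
  convexity gives the mean value inequality. This supplies the dominating functions for
  differentiation under the integral.\<close>

lemma C1_lipschitz_on_compact_convex:
  fixes f :: "'a::euclidean_space \<Rightarrow> real"
  assumes "compact S" "convex S"
    and deriv: "\<And>y. y \<in> S \<Longrightarrow> (f has_derivative f' y) (at y within S)"
    and cont: "\<And>v. continuous_on S (\<lambda>y. f' y v)"
  obtains L where "L \<ge> 0" "\<And>y z. y \<in> S \<Longrightarrow> z \<in> S \<Longrightarrow> \<bar>f y - f z\<bar> \<le> L * norm (y - z)"
proof -
  have "\<exists>B\<ge>0. \<forall>y\<in>S. \<bar>f' y v\<bar> \<le> B" for v
  proof -
    have "bounded ((\<lambda>y. f' y v) ` S)"
      using cont assms(1) by (intro compact_imp_bounded compact_continuous_image)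
    then show ?thesis
      unfolding bounded_pos by (auto intro: less_imp_le)
  qed
  then obtain B where B: "\<And>v. B v \<ge> 0" "\<And>v y. y \<in> S \<Longrightarrow> \<bar>f' y v\<bar> \<le> B v"
    by metis
  show ?thesis
  proof (rule that[of "\<Sum>b\<in>Basis. B b"])
    show "0 \<le> (\<Sum>b\<in>Basis. B b)"
      using B by (intro sum_nonneg) auto
    fix y z assume yz: "y \<in> S" "z \<in> S"
    have "onorm (f' w) \<le> (\<Sum>b\<in>Basis. B b)" if w: "w \<in> S" for w
    proof (rule onorm_le)
      fix v :: 'a
      have "linear (f' w)"
        using deriv[OF w] by (rule has_derivative_linear)
      then have "norm (f' w v) \<le> (\<Sum>b\<in>Basis. \<bar>(v \<bullet> b) * f' w b\<bar>)"
        by (subst linear_euclidean_expansion) (auto intro: sum_abs)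
      also have "\<dots> \<le> (\<Sum>b\<in>Basis. norm v * B b)"
        using B(2)[OF w] B(1) by (intro sum_mono) (auto simp: abs_mult Basis_le_norm intro!: mult_mono)
      finally show "norm (f' w v) \<le> (\<Sum>b\<in>Basis. B b) * norm v"
        by (simp add: sum_distrib_left mult.commute)
    qed
    then show "\<bar>f y - f z\<bar> \<le> (\<Sum>b\<in>Basis. B b) * norm (y - z)"
      using differentiable_bound[OF assms(2) deriv _ yz] by auto
  qed
qed

section \<open>Integration by parts on the unit ball from translation invariance\<close>

lemma integral_lborel_translate:
  fixes f :: "'a::euclidean_space \<Rightarrow> real"
  assumes [measurable]: "f \<in> borel_measurable borel"
  shows "(\<integral>z. f (z + c) \<partial>lborel) = (\<integral>z. f z \<partial>lborel)"
proof -
  have "(\<integral>z. f z \<partial>lborel) = (\<integral>z. f z \<partial>distr lborel borel ((+) c))"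
    by (simp add: lborel_distr_plus)
  also have "\<dots> = (\<integral>z. f (c + z) \<partial>lborel)"
    by (rule integral_distr) auto
  finally show ?thesis
    by (simp add: add.commute)
qed

lemma integrable_lborel_translate:
  fixes f :: "'a::euclidean_space \<Rightarrow> real"
  assumes "integrable lborel f"
  shows "integrable lborel (\<lambda>z. f (z + c))"
proof -
  have [measurable]: "f \<in> borel_measurable borel"
    using assms by auto
  have "integrable (distr lborel borel ((+) c)) f"
    using assms by (simp add: lborel_distr_plus)
  then show ?thesis
    by (subst (asm) integrable_distr_eq) (auto simp: add.commute)
qed

lemma AE_notin_sphere: "AE z in lborel. z \<notin> sphere (c::'a::euclidean_space) e"
proof -
  have "sphere c e \<in> null_sets lborel"
    using negligible_sphere[of c e]
    by (auto simp: null_sets_completion_iff negligible_iff_null_sets)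
  then show ?thesis
    by (rule AE_not_in)
qed

text \<open>The function \<open>G\<close> that equals \<open>g z * (1 - z \<bullet> z)\<close> on the unit ball and \<open>0\<close> elsewhere is
  Lipschitz, so that its translates can be differentiated under the integral sign; by translation
  invariance the result is \<open>0\<close>.\<close>

lemma integral_directional_derivative_bump:
  fixes g :: "'a::euclidean_space \<Rightarrow> real"
  assumes deriv: "\<And>z. z \<in> cball 0 1 \<Longrightarrow> (g has_derivative g' z) (at z)"
    and cont: "\<And>v. continuous_on (cball 0 1) (\<lambda>z. g' z v)"
    and nb: "norm b \<le> 1"
  shows "(\<integral>z. indicator (cball 0 1) z *\<^sub>R (g' z b * (1 - z \<bullet> z) - 2 * g z * (z \<bullet> b)) \<partial>lborel) = 0"
proof -
  let ?K = "cball 0 1 :: 'a set"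
  define h where "h z = g z * (1 - z \<bullet> z)" for z
  define h' where "h' z v = g' z v * (1 - z \<bullet> z) - 2 * g z * (z \<bullet> v)" for z v
  define G where "G z = indicator ?K z *\<^sub>R h z" for z
  have contg: "continuous_on ?K g"
    using deriv by (intro continuous_at_imp_continuous_on ballI has_derivative_continuous)
  have conth: "continuous_on ?K h"
    unfolding h_def by (intro continuous_intros contg)
  have conth': "continuous_on ?K (\<lambda>z. h' z v)" for v
    unfolding h'_def by (intro continuous_intros contg cont)
  have derh: "(h has_derivative h' z) (at z)" if "z \<in> ?K" for z
    unfolding h_def h'_def using deriv[OF that]
    by (auto intro!: derivative_eq_intros simp: algebra_simps inner_commute)
  obtain L where L: "L \<ge> 0" "\<And>y z. y \<in> ?K \<Longrightarrow> z \<in> ?K \<Longrightarrow> \<bar>h y - h z\<bar> \<le> L * norm (y - z)"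
    using C1_lipschitz_on_compact_convex[of ?K h h'] derh conth'
    by (auto intro: has_derivative_at_withinI)
  \<comment> \<open>Since \<open>h\<close> vanishes on the unit sphere, extending it by
    \<open>0\<close> is the same as composing it with the nearest-point projection onto the ball.
    That projection is 1-Lipschitz, so the Lipschitz constant of \<open>h\<close> on the ball serves
    for \<open>G\<close> on the whole space.\<close>
  have G_proj: "G z = h (closest_point ?K z)" for z
  proof (cases "z \<in> ?K")
    case True
    then show ?thesis
      by (simp add: G_def closest_point_self)
  next
    case False
    \<comment> \<open>The closest point to an exterior point cannot lie in the relative interior,
      which here is the open ball; hence it lies on the sphere.\<close>
    have "affine hull ?K = UNIV" "rel_interior ?K = ball 0 1"
      by (auto simp: affine_hull_nonempty_interior rel_interior_nonempty_interior interior_cball)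
    then have "closest_point ?K z \<in> sphere 0 1"
      using closest_point_in_rel_interior[of ?K z] closest_point_in_set[of ?K z] False by auto
    then have "closest_point ?K z \<bullet> closest_point ?K z = 1"
      by (simp add: dot_square_norm)
    then show ?thesis
      using False by (simp add: G_def h_def)
  qed
  have lipG: "\<bar>G y - G z\<bar> \<le> L * norm (y - z)" for y z
  proof -
    have "\<bar>G y - G z\<bar> \<le> L * dist (closest_point ?K y) (closest_point ?K z)"
      unfolding G_proj dist_norm by (intro L(2) closest_point_in_set) auto
    also have "\<dots> \<le> L * dist y z"
      using L(1) by (intro mult_left_mono closest_point_lipschitz) auto
    finally show ?thesis
      by (simp add: dist_norm)
  qed
  have intG: "integrable lborel G"
    unfolding G_def by (intro borel_integrable_compact conth compact_cball)
  have "((\<lambda>t. \<integral>z. G (z + t *\<^sub>R b) \<partial>lborel) has_field_derivative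
      (\<integral>z. indicator ?K z *\<^sub>R h' z b \<partial>lborel)) (at 0 within {-1..1})"
  \<comment> \<open>Radius 2 suffices: for \<open>t\<close> in \<open>{-1..1}\<close> and
    \<open>norm b \<le> 1\<close>, a point outside this ball stays outside the unit ball after
    translation by \<open>t\<close> times \<open>b\<close>, so \<open>G\<close> is \<open>0\<close>
    before and after.\<close>
  proof (rule has_field_derivative_integral[where L = "\<lambda>z. indicator (cball 0 2) z *\<^sub>R L"])
    show "integrable lborel (\<lambda>z. G (z + t *\<^sub>R b))" for t
      by (rule integrable_lborel_translate[OF intG])
    show "(\<lambda>z. indicator ?K z *\<^sub>R h' z b) \<in> borel_measurable lborel"
      using borel_measurable_continuous_on_indicator[OF _ conth', of b] by simp
    show "integrable lborel (\<lambda>z. indicator (cball 0 2 :: 'a set) z *\<^sub>R L)"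
      by (intro borel_integrable_compact) auto
    show "AE z in lborel. ((\<lambda>t. G (z + t *\<^sub>R b)) has_field_derivative
        indicator ?K z *\<^sub>R h' z b) (at 0 within {-1..1})"
      using AE_notin_sphere[of 0 1]
    proof eventually_elim
      fix z :: 'a assume z: "z \<notin> sphere 0 1"
      \<comment> \<open>Off the sphere, the line through \<open>z\<close> stays on one side of it
        for \<open>t\<close> near 0, so there \<open>G\<close> coincides with \<open>h\<close> or
        with \<open>0\<close>.\<close>
      have c: "open ((\<lambda>t. z + t *\<^sub>R b) -` U)" if "open U" for U
        by (intro open_vimage that continuous_intros)
      show "((\<lambda>t. G (z + t *\<^sub>R b)) has_field_derivative indicator ?K z *\<^sub>R h' z b)
          (at 0 within {-1..1})"
      proof (cases "z \<in> ball 0 1")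
        case True
        have "((\<lambda>t. h (z + t *\<^sub>R b)) has_derivative (\<lambda>t. h' (z + 0 *\<^sub>R b) (t *\<^sub>R b))) (at 0)"
          using True
          by (intro has_derivative_compose[of "\<lambda>t. z + t *\<^sub>R b" _ _ _ h] derh[THEN has_derivative_at_withinI])
            (auto intro!: derivative_eq_intros derh)
        moreover have "linear (h' z)"
          using True derh by (intro has_derivative_linear[OF derh]) auto
        ultimately have "((\<lambda>t. h (z + t *\<^sub>R b)) has_field_derivative h' z b) (at 0)"
          by (simp add: has_field_derivative_def linear_cmul mult_commute_abs)
        then have "((\<lambda>t. G (z + t *\<^sub>R b)) has_field_derivative h' z b) (at 0)"
          by (rule has_field_derivative_transform_within_open[OF _ c[OF open_ball[of 0 1]]])
            (use True in \<open>auto simp: G_def\<close>)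
        then show ?thesis
          using True by (auto intro: has_field_derivative_at_within)
      next
        case False
        have "((\<lambda>t. G (z + t *\<^sub>R b)) has_field_derivative 0) (at 0)"
          by (rule has_field_derivative_transform_within_open[OF DERIV_const[of 0] c[of "- ?K"]])
            (use False z in \<open>auto simp: G_def\<close>)
        then show ?thesis
          using False z by (auto intro: has_field_derivative_at_within)
      qed
    qed
    fix t :: real and z :: 'a
    assume t: "t \<in> {-1..1}"
    have tb: "norm (t *\<^sub>R b) \<le> \<bar>t\<bar>"
      using nb by (simp add: mult_left_le)
    show "\<bar>G (z + t *\<^sub>R b) - G (z + 0 *\<^sub>R b)\<bar> \<le> indicator (cball 0 2) z *\<^sub>R L * \<bar>t - 0\<bar>"
    proof (cases "z \<in> cball 0 2")
      case True
      have "\<bar>G (z + t *\<^sub>R b) - G z\<bar> \<le> L * norm (t *\<^sub>R b)"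
        using lipG[of "z + t *\<^sub>R b" z] by simp
      also have "\<dots> \<le> L * \<bar>t\<bar>"
        using tb L(1) by (intro mult_left_mono) auto
      finally show ?thesis
        using True by simp
    next
      case False
      have "norm z \<le> norm (z + t *\<^sub>R b) + norm (t *\<^sub>R b)"
        using norm_triangle_ineq4[of "z + t *\<^sub>R b" "t *\<^sub>R b"] by simp
      then have "norm (z + t *\<^sub>R b) > 1"
        using False t tb by auto
      then show ?thesis
        using False by (auto simp: G_def)
    qed
  qed simp
  moreover have "(\<integral>z. G (z + t *\<^sub>R b) \<partial>lborel) = (\<integral>z. G z \<partial>lborel)" for t
    using intG by (intro integral_lborel_translate) auto
  ultimately have "((\<lambda>t. \<integral>z. G z \<partial>lborel) has_field_derivative
      (\<integral>z. indicator ?K z *\<^sub>R h' z b \<partial>lborel)) (at 0 within {-1..1})"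
    by simp
  moreover have "at 0 within {-1..1::real} = at 0"
    by (rule at_within_interior) auto
  ultimately have "(\<integral>z. indicator ?K z *\<^sub>R h' z b \<partial>lborel) = 0"
    using DERIV_unique[OF _ DERIV_const] by metis
  then show ?thesis
    by (simp add: h'_def)
qed

section \<open>The mean value property of harmonic functions\<close>

lemma C2_with_continuous_on:
  assumes "C2_with D u u' u''"
  shows "continuous_on D u" "continuous_on D (\<lambda>y. u' y v)"
  using assms unfolding C2_with_def
  by (auto intro!: continuous_at_imp_continuous_on has_derivative_continuous)

text \<open>The bump identity is applied, for each basis vector \<open>b\<close>, to the partial
  derivative of \<open>u\<close> along \<open>b\<close> at \<open>x + \<rho> z\<close>. In the sum
  over \<open>b\<close> the second derivatives form \<open>\<rho> (1 - z \<bullet> z)\<close> times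
  the Laplacian, which vanishes, and what remains is \<open>-2\<close> times the radial
  derivative.\<close>

lemma harmonic_integral_radial_derivative:
  fixes u :: "'a::euclidean_space \<Rightarrow> real"
  assumes C2: "C2_with D u u' u''"
    and harm: "\<And>y. y \<in> D \<Longrightarrow> (\<Sum>b\<in>Basis. u'' y b b) = 0"
    and sub: "\<And>z. z \<in> cball 0 1 \<Longrightarrow> x + \<rho> *\<^sub>R z \<in> D"
  shows "(\<integral>z. indicator (cball 0 1) z *\<^sub>R u' (x + \<rho> *\<^sub>R z) z \<partial>lborel) = 0"
proof -
  let ?K = "cball 0 1 :: 'a set"
  let ?y = "\<lambda>z. x + \<rho> *\<^sub>R z"
  let ?F = "\<lambda>b z. u'' (?y z) b (\<rho> *\<^sub>R b) * (1 - z \<bullet> z) - 2 * u' (?y z) b * (z \<bullet> b)"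
  have y: "continuous_on ?K ?y" "?y ` ?K \<subseteq> D"
    using sub by (auto intro!: continuous_intros)
  have contu'': "continuous_on ?K (\<lambda>z. u'' (?y z) b v)" for b v
    using continuous_on_compose2[OF _ y, of "\<lambda>y. u'' y b v"] C2 by (simp add: C2_with_def)
  have contu': "continuous_on ?K (\<lambda>z. u' (?y z) b)" for b
    using continuous_on_compose2[OF C2_with_continuous_on(2)[OF C2] y] .
  have der: "((\<lambda>z. u' (?y z) b) has_derivative (\<lambda>v. u'' (?y z) b (\<rho> *\<^sub>R v))) (at z)"
    if "z \<in> ?K" for z b
  proof (rule has_derivative_compose[of ?y _ _ _ "\<lambda>y. u' y b"])
    show "(?y has_derivative (\<lambda>v. \<rho> *\<^sub>R v)) (at z)"
      by (auto intro!: derivative_eq_intros)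
    show "((\<lambda>y. u' y b) has_derivative u'' (?y z) b) (at (?y z))"
      using C2 sub[OF that] by (simp add: C2_with_def)
  qed
  have "(\<Sum>b\<in>Basis. \<integral>z. indicator ?K z *\<^sub>R ?F b z \<partial>lborel) = 0"
    using der contu'' by (intro sum.neutral ballI integral_directional_derivative_bump) auto
  moreover have "(\<Sum>b\<in>Basis. \<integral>z. indicator ?K z *\<^sub>R ?F b z \<partial>lborel)
      = (\<integral>z. (\<Sum>b\<in>Basis. indicator ?K z *\<^sub>R ?F b z) \<partial>lborel)"
    by (rule Bochner_Integration.integral_sum[symmetric])
      (intro borel_integrable_compact continuous_intros contu' contu'' compact_cball)
  moreover have "(\<Sum>b\<in>Basis. indicator ?K z *\<^sub>R ?F b z)
      = - 2 * (indicator ?K z *\<^sub>R u' (?y z) z)" for z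
  proof (cases "z \<in> ?K")
    case True
    have lin: "linear (u' (?y z))" "linear (u'' (?y z) b)" for b
      using C2 sub[OF True] unfolding C2_with_def by (blast dest: has_derivative_linear)+
    have "(\<Sum>b\<in>Basis. ?F b z)
        = \<rho> * (1 - z \<bullet> z) * (\<Sum>b\<in>Basis. u'' (?y z) b b) - 2 * (\<Sum>b\<in>Basis. (z \<bullet> b) * u' (?y z) b)"
      by (simp add: linear_cmul[OF lin(2)] sum_subtractf sum_distrib_left mult_ac)
    then show ?thesis
      using True harm[OF sub[OF True]] linear_euclidean_expansion[OF lin(1), of z] by simp
  qed simp
  ultimately show ?thesis
    by simp
qed

text \<open>Rescaling to a fixed ball puts the radius into the integrand. The integral then has zero
  derivative in the radius on \<open>{0..r}\<close>, so its value at \<open>r\<close> equals its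
  value at radius 0, where the integrand is the constant \<open>u x\<close>.\<close>

lemma harmonic_mean_value_unit_ball:
  fixes u :: "'a::euclidean_space \<Rightarrow> real"
  assumes C2: "C2_with D u u' u''"
    and harm: "\<And>y. y \<in> D \<Longrightarrow> (\<Sum>b\<in>Basis. u'' y b b) = 0"
    and r: "r \<ge> 0" and sub: "cball x r \<subseteq> D"
  shows "(\<integral>z. indicator (cball 0 1) z *\<^sub>R u (x + r *\<^sub>R z) \<partial>lborel) = u x * unit_ball_vol (real DIM('a))"
proof -
  let ?K = "cball 0 1 :: 'a set"
  define I where "I t = (\<integral>z. indicator ?K z *\<^sub>R u (x + t *\<^sub>R z) \<partial>lborel)" for t
  have in_ball: "x + t *\<^sub>R z \<in> cball x r" if "t \<in> {0..r}" "z \<in> ?K" for t z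
    using that mult_mono[of t r "norm z" 1] by (simp add: dist_norm)
  have cont_y: "continuous_on ?K (\<lambda>z. x + t *\<^sub>R z)" for t
    by (intro continuous_intros)
  have der: "(u has_derivative u' y) (at y)" if "y \<in> cball x r" for y
    using C2 sub that by (auto simp: C2_with_def)
  obtain L where L: "\<And>y z. y \<in> cball x r \<Longrightarrow> z \<in> cball x r \<Longrightarrow> \<bar>u y - u z\<bar> \<le> L * norm (y - z)" "L \<ge> 0"
    using C1_lipschitz_on_compact_convex[OF compact_cball convex_cball
        has_derivative_at_withinI[OF der] continuous_on_subset[OF C2_with_continuous_on(2)[OF C2] sub]]
    by metis
  have contu: "continuous_on ?K (\<lambda>z. u (x + t *\<^sub>R z))" if "t \<in> {0..r}" for t
    by (rule continuous_on_compose2[OF C2_with_continuous_on(1)[OF C2] cont_y]) (use in_ball[OF that] sub in blast)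
  have contu': "continuous_on ?K (\<lambda>z. u' (x + t *\<^sub>R z) b)" if "t \<in> {0..r}" for t b
    by (rule continuous_on_compose2[OF C2_with_continuous_on(2)[OF C2] cont_y]) (use in_ball[OF that] sub in blast)
  have "(I has_field_derivative 0) (at t within {0..r})" if t: "t \<in> {0..r}" for t
  proof -
    have lin: "linear (u' (x + t *\<^sub>R z))" if "z \<in> ?K" for z
      using der[OF in_ball[OF t that]] by (rule has_derivative_linear)
    have "(I has_field_derivative (\<integral>z. indicator ?K z *\<^sub>R u' (x + t *\<^sub>R z) z \<partial>lborel)) (at t within {0..r})"
      unfolding I_def
    proof (rule has_field_derivative_integral[where L = "\<lambda>z. indicator ?K z *\<^sub>R L"])
      show "integrable lborel (\<lambda>z. indicator ?K z *\<^sub>R u (x + s *\<^sub>R z))" if "s \<in> {0..r}" for s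
        using contu[OF that] by (intro borel_integrable_compact) auto
      show "t \<in> {0..r}"
        by (rule t)
      show "AE z in lborel. ((\<lambda>s. indicator ?K z *\<^sub>R u (x + s *\<^sub>R z)) has_field_derivative
          indicator ?K z *\<^sub>R u' (x + t *\<^sub>R z) z) (at t within {0..r})"
      proof (rule AE_I2)
        fix z :: 'a
        show "((\<lambda>s. indicator ?K z *\<^sub>R u (x + s *\<^sub>R z)) has_field_derivative
          indicator ?K z *\<^sub>R u' (x + t *\<^sub>R z) z) (at t within {0..r})"
        proof (cases "z \<in> ?K")
          case True
          have "((\<lambda>s. u (x + s *\<^sub>R z)) has_derivative (\<lambda>h. u' (x + t *\<^sub>R z) (h *\<^sub>R z))) (at t within {0..r})"
            by (rule has_derivative_compose[of "\<lambda>s. x + s *\<^sub>R z" _ _ _ u])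
              (auto intro!: derivative_eq_intros der in_ball t True)
          then have "((\<lambda>s. u (x + s *\<^sub>R z)) has_field_derivative u' (x + t *\<^sub>R z) z) (at t within {0..r})"
            by (simp add: has_field_derivative_def linear_cmul[OF lin[OF True]] mult_commute_abs)
          then show ?thesis
            using True by simp
        qed simp
      qed
      \<comment> \<open>Continuity of \<open>u'\<close> is known only for a fixed direction, whereas
        here the direction is \<open>z\<close> itself; expanding in the basis separates the two
        dependences.\<close>
      have "continuous_on ?K (\<lambda>z. u' (x + t *\<^sub>R z) z)"
        by (rule continuous_on_eq[of _ "\<lambda>z. \<Sum>b\<in>Basis. (z \<bullet> b) * u' (x + t *\<^sub>R z) b"])
          (auto intro!: continuous_intros contu' t linear_euclidean_expansion[OF lin, symmetric])
      then show "(\<lambda>z. indicator ?K z *\<^sub>R u' (x + t *\<^sub>R z) z) \<in> borel_measurable lborel"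
        using borel_measurable_continuous_on_indicator[of ?K "\<lambda>z. u' (x + t *\<^sub>R z) z"] by simp
      show "integrable lborel (\<lambda>z. indicator ?K z *\<^sub>R L)"
        by (intro borel_integrable_compact) auto
      fix s z assume s: "s \<in> {0..r}"
      show "\<bar>indicator ?K z *\<^sub>R u (x + s *\<^sub>R z) - indicator ?K z *\<^sub>R u (x + t *\<^sub>R z)\<bar>
          \<le> indicator ?K z *\<^sub>R L * \<bar>s - t\<bar>"
      proof (cases "z \<in> ?K")
        case True
        have "\<bar>u (x + s *\<^sub>R z) - u (x + t *\<^sub>R z)\<bar> \<le> L * norm ((x + s *\<^sub>R z) - (x + t *\<^sub>R z))"
          by (intro L in_ball s t True)
        also have "(x + s *\<^sub>R z) - (x + t *\<^sub>R z) = (s - t) *\<^sub>R z"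
          by (simp add: algebra_simps)
        also have "L * norm ((s - t) *\<^sub>R z) \<le> L * \<bar>s - t\<bar>"
          using True L(2) by (intro mult_left_mono) (auto simp: mult_left_le)
        finally show ?thesis
          using True by simp
      qed simp
    qed
    moreover have "(\<integral>z. indicator ?K z *\<^sub>R u' (x + t *\<^sub>R z) z \<partial>lborel) = 0"
      using in_ball[OF t] sub by (intro harmonic_integral_radial_derivative[OF C2 harm]) auto
    ultimately show ?thesis
      by simp
  qed
  then obtain c where "\<And>t. t \<in> {0..r} \<Longrightarrow> I t = c"
    using has_field_derivative_zero_constant[of "{0..r}" I] by auto
  then have "I r = I 0"
    using r by auto
  also have "I 0 = u x * unit_ball_vol (real DIM('a))"
    by (simp add: I_def content_cball)
  finally show ?thesis
    by (simp add: I_def)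
qed

lemma harmonic_mean_value_cball:
  fixes u :: "'a::euclidean_space \<Rightarrow> real"
  assumes C2: "C2_with D u u' u''"
    and harm: "\<And>y. y \<in> D \<Longrightarrow> (\<Sum>b\<in>Basis. u'' y b b) = 0"
    and r: "r > 0" and sub: "cball x r \<subseteq> D"
  shows "(\<integral>y. indicator (cball x r) y *\<^sub>R u y \<partial>lborel)
    = u x * unit_ball_vol (real DIM('a)) * r ^ DIM('a)"
proof -
  define f where "f y = indicator (cball x r) y *\<^sub>R u y" for y
  have [measurable]: "f \<in> borel_measurable borel"
    unfolding f_def using C2_with_continuous_on(1)[OF C2] sub
    by (intro borel_measurable_continuous_on_indicator) (auto intro: continuous_on_subset)
  have "integral\<^sup>L lborel f
      = integral\<^sup>L (density (distr lborel borel (\<lambda>z. x + r *\<^sub>R z)) (\<lambda>_. \<bar>r\<bar> ^ DIM('a))) f"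
    using r by (intro arg_cong[where f = "\<lambda>M. integral\<^sup>L M f"] lborel_affine) auto
  also have "\<dots> = (\<integral>z. r ^ DIM('a) *\<^sub>R f (x + r *\<^sub>R z) \<partial>lborel)"
    using r by (simp add: integral_density integral_distr)
  also have "\<dots> = r ^ DIM('a) * (\<integral>z. indicator (cball 0 1) z *\<^sub>R u (x + r *\<^sub>R z) \<partial>lborel)"
    using r by (auto simp: f_def indicator_def dist_norm intro!: Bochner_Integration.integral_cong
        simp flip: integral_mult_right_zero)
  finally show ?thesis
    using harmonic_mean_value_unit_ball[OF C2 harm less_imp_le[OF r] sub] by (simp add: f_def[abs_def])
qed

section \<open>Integrals against radial power weights\<close>

text \<open>For \<open>a < 0\<close> the integrand is unbounded at 0. The gauge integral is known,
  and as the integrand is nonnegative it is also absolutely integrable, so the value carries over to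
  the Lebesgue integral.\<close>

lemma has_bochner_integral_powr_from_0:
  assumes "a > -1" "r \<ge> 0"
  shows "has_bochner_integral lborel (\<lambda>t::real. indicator {0..r} t * t powr a) (r powr (a + 1) / (a + 1))"
proof -
  let ?f = "\<lambda>t. indicator {0..r} t * t powr a"
  have hi: "((\<lambda>t. t powr a) has_integral (r powr (a + 1) / (a + 1))) {0..r}"
    by (rule has_integral_powr_from_0[OF assms])
  have "set_integrable lebesgue {0..r} (\<lambda>t. t powr a)"
    using hi by (subst absolutely_integrable_on_iff_nonneg) (auto simp: has_integral_iff)
  then have int: "integrable lborel ?f"
    unfolding set_integrable_def by (subst (asm) integrable_completion) auto
  have "(?f has_integral (r powr (a + 1) / (a + 1))) UNIV"
    using hi by (subst (asm) has_integral_restrict_UNIV[symmetric])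
      (auto elim!: has_integral_eq_rhs has_integral_eq[rotated] simp: indicator_def)
  with has_integral_integral_real[OF int] have "integral\<^sup>L lborel ?f = r powr (a + 1) / (a + 1)"
    by (rule has_integral_unique)
  with int show ?thesis
    by (simp add: has_bochner_integral_iff)
qed

text \<open>The Fubini step, for either sign of \<open>p\<close>. The hypothesis on \<open>c\<close>
  is the mean value property in undivided form; it is satisfied by harmonic functions cut off
  outside a ball and also by the constant 1.\<close>

lemma has_bochner_integral_ball_radial_weight:
  fixes f :: "'a::euclidean_space \<Rightarrow> real"
  assumes f[measurable]: "f \<in> borel_measurable borel" and B: "\<And>y. \<bar>f y\<bar> \<le> B"
    and r: "r > 0" and p: "p + real DIM('a) > 0"
    and c: "\<And>t. 0 < t \<Longrightarrow> t \<le> r \<Longrightarrow>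
      (\<integral>y. indicator (cball x t) y * f y \<partial>lborel) = c * t ^ DIM('a)"
  shows "has_bochner_integral lborel
    (\<lambda>y. indicator (ball x r) y * (f y * (r powr p - dist x y powr p)))
    (c * (p / (p + real DIM('a))) * r powr (p + real DIM('a)))"
proof -
  let ?m = "DIM('a)"
  let ?V = "unit_ball_vol (real ?m)"
  define k where "k t = p * t powr (p - 1)" for t :: real
  \<comment> \<open>Integrating \<open>H\<close> over \<open>t\<close> first produces the weight
    times \<open>f\<close>; integrating over \<open>y\<close> first produces \<open>k t\<close>
    times the integral of \<open>f\<close> over the ball of radius \<open>t\<close>.\<close>
  define H where "H t y = indicator {0<..r} t * k t * (indicator {z. dist x z \<le> t} y * f y)" for t y
  have [measurable]: "k \<in> borel_measurable borel"
    unfolding k_def by measurable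
  have H_eq: "H t y = (if 0 < t \<and> t \<le> r \<and> dist x y \<le> t then k t * f y else 0)" for t y
    by (auto simp: H_def)
  have H_meas: "case_prod H \<in> borel_measurable (lborel \<Otimes>\<^sub>M lborel)"
    unfolding H_eq by measurable
  have H_inner: "(\<integral>y. H t y \<partial>lborel) = indicator {0<..r} t * k t * (\<integral>y. indicator (cball x t) y * f y \<partial>lborel)" for t
    unfolding H_def by (subst integral_mult_right_zero) (simp add: cball_def)
  have int_cball: "integrable lborel (\<lambda>y. indicator (cball x t) y * f y)" for t
  proof (rule Bochner_Integration.integrable_bound)
    show "integrable lborel (\<lambda>y. indicator (cball x t) y *\<^sub>R B)"
      by (intro borel_integrable_compact) auto
    show "AE y in lborel. norm (indicator (cball x t) y * f y) \<le> norm (indicator (cball x t) y *\<^sub>R B)"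
      using B by (auto simp: indicator_def intro: order_trans[OF _ abs_ge_self])
    show "(\<lambda>y. indicator (cball x t) y * f y) \<in> borel_measurable lborel"
      using f by (intro borel_measurable_times borel_measurable_indicator) auto
  qed
  have powr_eq: "t powr (p - 1) * t ^ ?m = t powr (p + ?m - 1)" if "t > 0" for t
    using that by (simp flip: powr_realpow powr_add) (simp add: algebra_simps)
  \<comment> \<open>The inner integral of the absolute value is at most
    \<open>\<bar>p\<bar> * B * ?V * t powr (p + ?m - 1)\<close>, which is integrable at 0 precisely
    because \<open>p + ?m > 0\<close>.\<close>
  have H_int: "integrable (lborel \<Otimes>\<^sub>M lborel) (case_prod H)"
  proof (rule lborel_pair.Fubini_integrable[OF H_meas])
    show "AE t in lborel. integrable lborel (\<lambda>y. case_prod H (t, y))"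
      using int_cball by (auto simp: H_def cball_def)
    show "integrable lborel (\<lambda>t. \<integral>y. norm (case_prod H (t, y)) \<partial>lborel)"
    proof (rule Bochner_Integration.integrable_bound)
      show "integrable lborel (\<lambda>t. (\<bar>p\<bar> * B * ?V) * (indicator {0..r} t * t powr (p + ?m - 1)))"
        using has_bochner_integral_powr_from_0[of "p + ?m - 1" r] p r
        by (intro integrable_mult_right) (auto simp: has_bochner_integral_iff)
      show "(\<lambda>t. \<integral>y. norm (case_prod H (t, y)) \<partial>lborel) \<in> borel_measurable lborel"
        using H_meas by measurable
      show "AE t in lborel. norm (\<integral>y. norm (case_prod H (t, y)) \<partial>lborel)
          \<le> norm ((\<bar>p\<bar> * B * ?V) * (indicator {0..r} t * t powr (p + ?m - 1)))"
      proof (rule AE_I2)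
        fix t :: real
        have B0: "B \<ge> 0"
          using B[of 0] by linarith
        show "norm (\<integral>y. norm (case_prod H (t, y)) \<partial>lborel)
          \<le> norm ((\<bar>p\<bar> * B * ?V) * (indicator {0..r} t * t powr (p + ?m - 1)))"
        proof (cases "0 < t \<and> t \<le> r")
          case True
          have "(\<integral>y. norm (case_prod H (t, y)) \<partial>lborel) \<le> (\<integral>y. indicator (cball x t) y *\<^sub>R (\<bar>k t\<bar> * B) \<partial>lborel)"
          proof (rule integral_mono)
            show "integrable lborel (\<lambda>y. norm (case_prod H (t, y)))"
              using int_cball by (intro integrable_norm) (auto simp: H_def cball_def)
            show "integrable lborel (\<lambda>y. indicator (cball x t) y *\<^sub>R (\<bar>k t\<bar> * B))"
              by (intro borel_integrable_compact) auto
          qed (use B B0 in \<open>auto simp: H_eq abs_mult intro!: mult_left_mono\<close>)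
          also have "\<dots> = (\<bar>k t\<bar> * B) * (?V * t ^ ?m)"
            using True by (simp add: content_cball)
          also have "\<dots> = (\<bar>p\<bar> * B * ?V) * (t powr (p - 1) * t ^ ?m)"
            by (simp add: k_def abs_mult)
          also have "t powr (p - 1) * t ^ ?m = t powr (p + ?m - 1)"
            using True by (intro powr_eq) auto
          finally show ?thesis
            using True B0 by (simp add: abs_mult)
        qed (auto simp: H_eq)
      qed
    qed
  qed
  \<comment> \<open>The centre is left out because for \<open>p < 0\<close> the antiderivative
    \<open>t powr p\<close> is singular at 0; a single point is a null set.\<close>
  have inner: "(\<integral>t. H t y \<partial>lborel) = indicator (ball x r) y * (f y * (r powr p - dist x y powr p))" if "y \<noteq> x" for y
  proof (cases "dist x y \<le> r")
    case True
    have pos: "dist x y > 0"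
      using that by simp
    have "(\<integral>t. H t y \<partial>lborel) = (\<integral>t. (indicator {dist x y..r} t *\<^sub>R k t) * f y \<partial>lborel)"
      using less_le_trans[OF pos]
      by (intro Bochner_Integration.integral_cong) (auto simp: H_eq indicator_def)
    also have "\<dots> = (\<integral>t. indicator {dist x y..r} t *\<^sub>R k t \<partial>lborel) * f y"
      by (rule integral_mult_left_zero)
    also have "(\<integral>t. indicator {dist x y..r} t *\<^sub>R k t \<partial>lborel) = r powr p - dist x y powr p"
    proof (rule integral_FTC_Icc[OF True])
      show "((\<lambda>t. t powr p) has_vector_derivative k t) (at t within {dist x y..r})"
        if "dist x y \<le> t" for t
        using less_le_trans[OF pos that] unfolding has_real_derivative_iff_has_vector_derivative[symmetric] k_def
        by (auto intro!: derivative_eq_intros)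
      show "continuous_on {dist x y..r} k"
        unfolding k_def using pos by (auto intro!: continuous_intros)
    qed
    \<comment> \<open>The passage from the closed to the open ball is free: at
      \<open>dist x y = r\<close> the weight is 0.\<close>
    finally show ?thesis
      using True by (auto simp: indicator_def)
  next
    case False
    then have "H t y = 0" for t
      by (simp add: H_eq)
    then show ?thesis
      using False by simp
  qed
  have AE_inner: "AE y in lborel. (\<integral>t. H t y \<partial>lborel) = indicator (ball x r) y * (f y * (r powr p - dist x y powr p))"
    using AE_lborel_singleton[of x] by eventually_elim (rule inner)
  have meas: "(\<lambda>y. indicator (ball x r) y * (f y * (r powr p - dist x y powr p))) \<in> borel_measurable lborel"
    using f by (intro borel_measurable_times borel_measurable_indicator borel_measurable_diff) auto
  have meas': "(\<lambda>y. \<integral>t. H t y \<partial>lborel) \<in> borel_measurable lborel"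
    using lborel_pair.integrable_snd[OF H_int] by (rule borel_measurable_integrable)
  have "integrable lborel (\<lambda>y. indicator (ball x r) y * (f y * (r powr p - dist x y powr p)))"
    using lborel_pair.integrable_snd[OF H_int] integrable_cong_AE[OF meas' meas AE_inner] by simp
  moreover have "(\<integral>y. indicator (ball x r) y * (f y * (r powr p - dist x y powr p)) \<partial>lborel)
      = c * (p / (p + ?m)) * r powr (p + ?m)"
  proof -
    have "(\<integral>y. indicator (ball x r) y * (f y * (r powr p - dist x y powr p)) \<partial>lborel)
        = (\<integral>y. \<integral>t. H t y \<partial>lborel \<partial>lborel)"
      by (rule integral_cong_AE[OF meas' meas AE_inner, symmetric])
    also have "\<dots> = (\<integral>t. \<integral>y. H t y \<partial>lborel \<partial>lborel)"
      by (rule lborel_pair.Fubini_integral[OF H_int])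
    also have "\<dots> = (\<integral>t. (c * p) * (indicator {0..r} t * t powr (p + ?m - 1)) \<partial>lborel)"
    proof (rule Bochner_Integration.integral_cong[OF refl])
      fix t :: real
      have "k t * (c * t ^ ?m) = c * p * t powr (p + ?m - 1)" if "t > 0"
        using powr_eq[OF that] by (simp add: k_def mult_ac)
      then show "(\<integral>y. H t y \<partial>lborel) = (c * p) * (indicator {0..r} t * t powr (p + ?m - 1))"
        \<comment> \<open>The intervals \<open>{0<..r}\<close> and \<open>{0..r}\<close> differ only
          at \<open>t = 0\<close>, where the right-hand side is 0 as well because
          \<open>0 powr a = 0\<close>.\<close>
        unfolding H_inner using c[of t] by (cases "t = 0") (auto simp: indicator_def)
    qed
    also have "\<dots> = (c * p) * (r powr (p + ?m) / (p + ?m))"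
      using has_bochner_integral_powr_from_0[of "p + ?m - 1" r] p r
      by (simp add: has_bochner_integral_iff)
    finally show ?thesis
      by simp
  qed
  ultimately show ?thesis
    by (simp add: has_bochner_integral_iff)
qed

text \<open>The constant function 1 satisfies the ball hypothesis with \<open>c\<close> the volume
  of the unit ball. This makes \<open>r powr p - dist x y powr p\<close> integrable, and subtracting
  it from the constant \<open>r powr p\<close> leaves the power of the distance.\<close>

lemma dist_powr_set_integrable_ball:
  fixes x :: "'a::euclidean_space"
  assumes r: "r > 0" and p: "p + real DIM('a) > 0"
  shows "set_integrable lborel (ball x r) (\<lambda>y. dist x y powr p)"
proof -
  have "has_bochner_integral lborel
      (\<lambda>y. indicator (ball x r) y * (1 * (r powr p - dist x y powr p)))
      (unit_ball_vol (real DIM('a)) * (p / (p + real DIM('a))) * r powr (p + real DIM('a)))"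
    by (rule has_bochner_integral_ball_radial_weight[where B = 1])
      (use r p in \<open>auto simp: content_cball\<close>)
  then have "integrable lborel (\<lambda>y. indicator (ball x r) y * (r powr p - dist x y powr p))"
    by (simp add: has_bochner_integral_iff)
  moreover have "integrable lborel (\<lambda>y. indicator (ball x r) y * r powr p)"
    using emeasure_lborel_ball_finite[of x r] by (intro integrable_mult_left integrable_real_indicator) auto
  ultimately have "integrable lborel (\<lambda>y. indicator (ball x r) y * r powr p
      - indicator (ball x r) y * (r powr p - dist x y powr p))"
    by (rule Bochner_Integration.integrable_diff[rotated])
  then show ?thesis
    by (simp add: set_integrable_def algebra_simps)
qed

lemma dist_powr_set_integrable_bounded:
  fixes x :: "'a::euclidean_space"
  assumes p: "p + real DIM('a) > 0" and S: "bounded S" "S \<in> sets borel"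
  shows "set_integrable lebesgue S (\<lambda>y. dist x y powr p)"
proof -
  obtain R where R: "R > 0" "S \<subseteq> ball x R"
    using bounded_subset_ballD[OF S(1), of x] by auto
  have "set_integrable lborel S (\<lambda>y. dist x y powr p)"
    using dist_powr_set_integrable_ball[OF R(1) p] _ R(2) by (rule set_integrable_subset) (use S in auto)
  then show ?thesis
    using S(2) unfolding set_integrable_def by (subst integrable_completion) auto
qed

section \<open>The weighted ball formulas for harmonic functions\<close>

text \<open>The common form of both formulas, obtained from the mean value property on all
  concentric balls of radius at most \<open>r\<close>.\<close>

lemma harmonic_ball_radial_weight:
  fixes u :: "'a::euclidean_space \<Rightarrow> real"
  assumes u: "harmonic_on D u" and r: "r > 0" and sub: "cball x r \<subseteq> D"
    and p: "p + real DIM('a) > 0"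
  shows "set_integrable lebesgue (ball x r) (\<lambda>y. u y * (r powr p - dist x y powr p))"
    and "(LINT y:ball x r|lebesgue. u y * (r powr p - dist x y powr p))
      = measure lebesgue (ball x r) * (p / (p + real DIM('a)) * r powr p * u x)"
proof -
  let ?m = "DIM('a)"
  let ?V = "unit_ball_vol (real ?m)"
  let ?w = "\<lambda>y. r powr p - dist x y powr p"
  obtain u' u'' where C2: "C2_with D u u' u''" and harm: "\<And>y. y \<in> D \<Longrightarrow> (\<Sum>b\<in>Basis. u'' y b b) = 0"
    using u by (auto simp: harmonic_on_def)
  have cont: "continuous_on (cball x r) u"
    using C2_with_continuous_on(1)[OF C2] sub by (rule continuous_on_subset)
  \<comment> \<open>Cutting \<open>u\<close> off outside the closed ball gives a function that is
    Borel and bounded on the whole space, without changing its integrals over balls of radius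
    \<open>t \<le> r\<close>.\<close>
  define f where "f y = indicator (cball x r) y *\<^sub>R u y" for y
  have f: "f \<in> borel_measurable borel"
    unfolding f_def by (intro borel_measurable_continuous_on_indicator cont) auto
  have "bounded (u ` cball x r)"
    by (intro compact_imp_bounded compact_continuous_image cont compact_cball)
  then obtain B where "B > 0" "\<And>y. y \<in> cball x r \<Longrightarrow> \<bar>u y\<bar> \<le> B"
    unfolding bounded_pos by auto
  then have B: "\<bar>f y\<bar> \<le> B" for y
    by (auto simp: f_def indicator_def)
  have mean: "(\<integral>y. indicator (cball x t) y * f y \<partial>lborel) = u x * ?V * t ^ ?m" if "0 < t" "t \<le> r" for t
  proof -
    have "cball x t \<subseteq> D"
      using sub that by auto
    moreover have "indicator (cball x t) y * f y = indicator (cball x t) y *\<^sub>R u y" for y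
      using that by (auto simp: f_def indicator_def)
    ultimately show ?thesis
      using harmonic_mean_value_cball[OF C2 harm that(1)] by (simp only:)
  qed
  have eq: "indicator (ball x r) y * (f y * ?w y) = indicator (ball x r) y *\<^sub>R (u y * ?w y)" for y
    by (auto simp: f_def indicator_def)
  have hb: "has_bochner_integral lborel (\<lambda>y. indicator (ball x r) y *\<^sub>R (u y * ?w y))
      (u x * ?V * (p / (p + real ?m)) * r powr (p + real ?m))"
    using has_bochner_integral_ball_radial_weight[OF f B r p mean] by (simp only: eq)
  \<comment> \<open>For a Borel function, integrability and integral are the same for
    \<open>lborel\<close> and for its completion \<open>lebesgue\<close>.\<close>
  then have hbM: "(\<lambda>y. indicator (ball x r) y *\<^sub>R (u y * ?w y)) \<in> borel_measurable lborel"
    by (auto simp: has_bochner_integral_iff)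
  show "set_integrable lebesgue (ball x r) (\<lambda>y. u y * ?w y)"
    using hb unfolding set_integrable_def integrable_completion[OF hbM]
    by (simp add: has_bochner_integral_iff)
  have "(LINT y:ball x r|lebesgue. u y * ?w y) = u x * ?V * (p / (p + real ?m)) * r powr (p + real ?m)"
    using hb unfolding set_lebesgue_integral_def integral_completion[OF hbM]
    by (simp add: has_bochner_integral_iff)
  also have "\<dots> = measure lebesgue (ball x r) * (p / (p + real ?m) * r powr p * u x)"
    using r by (simp add: content_ball powr_add powr_realpow)
  finally show "(LINT y:ball x r|lebesgue. u y * ?w y)
      = measure lebesgue (ball x r) * (p / (p + real ?m) * r powr p * u x)" .
qed

theorem theorem4:
  fixes D :: "'a::euclidean_space set" and u :: "'a \<Rightarrow> real"
  assumes "DIM('a) \<ge> 2"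
    and "open D" and "connected D"
    and "C2_on D u" and "harmonic_on D u"
  shows "(\<forall>x\<in>D. \<forall>r>0. cball x r \<subseteq> D \<longrightarrow>
            (\<forall>\<alpha>. 0 < \<alpha> \<and> \<alpha> < real DIM('a) \<longrightarrow>
               set_integrable lebesgue (ball x r)
                 (\<lambda>y. u y * (dist x y powr (\<alpha> - real DIM('a)) - r powr (\<alpha> - real DIM('a)))) \<and>
               (real DIM('a) / \<alpha> - 1) * r powr (\<alpha> - real DIM('a)) * u x =
                 (1 / measure lebesgue (ball x r)) *
                 (LINT y:ball x r|lebesgue. u y * (dist x y powr (\<alpha> - real DIM('a)) - r powr (\<alpha> - real DIM('a))))) \<and>
            (\<forall>\<beta>>0.
               set_integrable lebesgue (ball x r)
                 (\<lambda>y. u y * (r powr \<beta> - dist x y powr \<beta>)) \<and>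
               (1 - real DIM('a) / (real DIM('a) + \<beta>)) * r powr \<beta> * u x =
                 (1 / measure lebesgue (ball x r)) *
                 (LINT y:ball x r|lebesgue. u y * (r powr \<beta> - dist x y powr \<beta>))))
       \<and> (\<forall>(x::'a) r \<alpha> \<beta> (\<Omega>::'a set). r > 0 \<and> 0 < \<alpha> \<and> \<alpha> < real DIM('a) \<and> \<beta> > 0 \<and>
            open \<Omega> \<and> connected \<Omega> \<and> bounded \<Omega> \<longrightarrow>
            set_integrable lebesgue \<Omega> (\<lambda>y. dist x y powr (\<alpha> - real DIM('a)) - r powr (\<alpha> - real DIM('a))) \<and>
            set_integrable lebesgue \<Omega> (\<lambda>y. r powr \<beta> - dist x y powr \<beta>))"
proof (intro conjI ballI allI impI; (elim conjE)?)
  fix x r assume r: "r > (0::real)" and sub: "cball x r \<subseteq> D"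
  have V: "measure lebesgue (ball x r) > 0"
    using r by simp
  {
    fix \<alpha> :: real assume \<alpha>: "0 < \<alpha>" "\<alpha> < real DIM('a)"
    let ?p = "\<alpha> - real DIM('a)"
    have p: "?p + real DIM('a) > 0"
      using \<alpha> by simp
    \<comment> \<open>The first formula has the weight with the opposite sign; accordingly its
      constant is \<open>- (?p / \<alpha>)\<close>, that is
      \<open>real DIM('a) / \<alpha> - 1\<close>.\<close>
    have neg: "u y * (dist x y powr ?p - r powr ?p) = - (u y * (r powr ?p - dist x y powr ?p))" for y
      by (simp add: algebra_simps)
    show "set_integrable lebesgue (ball x r) (\<lambda>y. u y * (dist x y powr ?p - r powr ?p))"
      unfolding neg using harmonic_ball_radial_weight(1)[OF assms(5) r sub p]
      by (simp add: set_integrable_def)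
    have "(LINT y:ball x r|lebesgue. u y * (dist x y powr ?p - r powr ?p))
        = - (measure lebesgue (ball x r) * (?p / \<alpha> * r powr ?p * u x))"
      unfolding neg using harmonic_ball_radial_weight(2)[OF assms(5) r sub p]
      by (simp add: set_lebesgue_integral_def)
    then show "(real DIM('a) / \<alpha> - 1) * r powr ?p * u x = 1 / measure lebesgue (ball x r) *
        (LINT y:ball x r|lebesgue. u y * (dist x y powr ?p - r powr ?p))"
      using V \<alpha> by (simp add: field_simps)
  }
  {
    fix \<beta> :: real assume \<beta>: "\<beta> > 0"
    then have p: "\<beta> + real DIM('a) > 0"
      by simp
    show "set_integrable lebesgue (ball x r) (\<lambda>y. u y * (r powr \<beta> - dist x y powr \<beta>))"
      by (rule harmonic_ball_radial_weight(1)[OF assms(5) r sub p])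
    \<comment> \<open>Here \<open>p = \<beta>\<close>, and the constant
      \<open>\<beta> / (\<beta> + real DIM('a))\<close> is the bracket on the left.\<close>
    show "(1 - real DIM('a) / (real DIM('a) + \<beta>)) * r powr \<beta> * u x = 1 / measure lebesgue (ball x r) *
        (LINT y:ball x r|lebesgue. u y * (r powr \<beta> - dist x y powr \<beta>))"
      unfolding harmonic_ball_radial_weight(2)[OF assms(5) r sub p]
      using V p by (simp add: field_simps)
  }
next
  fix x :: 'a and r \<alpha> \<beta> :: real and \<Omega> :: "'a set"
  assume a: "0 < \<alpha>" "\<beta> > 0" "open \<Omega>" "bounded \<Omega>"
  \<comment> \<open>A bounded open set has finite measure, so the constant terms of both weights are
    integrable and only the powers of the distance remain.\<close>
  have const: "set_integrable lebesgue \<Omega> (\<lambda>y. c)" for c :: real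
    using a lmeasurable_open[of \<Omega>] by (auto simp: set_integrable_def fmeasurable_def)
  show "set_integrable lebesgue \<Omega> (\<lambda>y. dist x y powr (\<alpha> - real DIM('a)) - r powr (\<alpha> - real DIM('a)))"
    using a by (intro set_integral_diff(1) const dist_powr_set_integrable_bounded) auto
  show "set_integrable lebesgue \<Omega> (\<lambda>y. r powr \<beta> - dist x y powr \<beta>)"
    using a by (intro set_integral_diff(1) const dist_powr_set_integrable_bounded) auto
qed

end
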